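(* Let $P:\subseteq\mathbb{N}^{\mathbb{N}}\rightrightarrows\mathbb{N}^{\mathbb{N}}$ be a problem, let $\alpha$ be a countable ordinal, and suppose that Player 2 has a winning strategy in the rank-$\alpha$ discontinuity game for $P$. Then for all sets $A\subseteq\mathbb{N}^{\mathbb{N}}$ with $\mathrm{rankp}(A)\le\alpha$, the restriction $P|_A$ is continuous.
   Context: $\mathbb{N}^{\mathbb{N}}$ is Baire space; $\sigma\sqsubseteq x$ means the finite string $\sigma$ is an initial segment of $x$, and $[\![\sigma]\!]=\{x\in\mathbb{N}^{\mathbb{N}}:\sigma\sqsubseteq x\}$. A problem $P:\subseteq\mathbb{N}^{\mathbb{N}}\rightrightarrows\mathbb{N}^{\mathbb{N}}$ is a partial multivalued function: a set $\mathrm{dom}(P)$ of instances and, for each $p\in\mathrm{dom}(P)$, a set $P(p)\subseteq\mathbb{N}^{\mathbb{N}}$ of solutions; $P(p)=\emptyset$ is allowed. $P|_A$ has domain $\mathrm{dom}(P)\cap A$. $P|[A\times B]$ has domain $\mathrm{dom}(P)\cap A$ and $P|[A\times B](x)=P(x)\cap B$. $P$ is continuous if there is a continuous partial function $\Phi$ defined on $\mathrm{dom}(P)$ with $\Phi(p)\in P(p)$ for all $p\in\mathrm{dom}(P)$. **Rank.** For $p\in A\subseteq\mathbb{N}^{\mathbb{N}}$, $\mathrm{rank}_A(p)$ is the Cantor–Bendixson rank: the ordinal $\alpha$ with $p\in A^{(\alpha)}\setminus A^{(\alpha+1)}$ (iterated Cantor–Bendixson derivatives; isolated points have rank $0$),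 or $\infty$ if there is none. $\mathrm{rankp}(A)$ is the least ordinal $\alpha$ such that $\mathrm{rank}_A(p)\le\alpha$ for all $p\in A$ ($\infty$ if none exists). **Rank-$\alpha$ discontinuity game for $P$** (recursive definition, $\alpha$ countable). Step 1: Player 1 plays $p\in\mathrm{dom}(P)$. Step 2: if $P(p)=\emptyset$, Player 1 wins and the game ends; otherwise Player 2 plays $q\in P(p)$. Step 3: if $\alpha=0$ (and Player 1 has not already won), Player 2 wins and the game ends; otherwise Player 1 plays a finite $\rho\sqsubseteq q$. Step 4: Player 2 plays a finite $\sigma\sqsubseteq p$. Step 5: Player 1 chooses $\gamma<\alpha$ and the players play the rank-$\gamma$ discontinuity game for $P|[[\![\sigma]\!]\times[\![\rho]\!]]$; its winner wins. *)

theory Defs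
  imports "HOL-Analysis.Analysis"
begin

section \<open>Countable ordinals\<close>

text \<open>The type \<open>omega1\<close> is (a copy of) the first uncountable ordinal; its elements are exactly
  the countable ordinals, each one corresponding to the order type of its initial segment.\<close>

typedef omega1 = "Field (cardSuc natLeq)"
proof -
  have "infinite (Field (cardSuc natLeq))"
    using cardSuc_finite[OF natLeq_Card_order] Field_natLeq by simp
  then show ?thesis by (metis ex_in_conv finite.emptyI)
qed

instantiation omega1 :: wellorder
begin

definition less_eq_omega1 :: "omega1 \<Rightarrow> omega1 \<Rightarrow> bool"
  where "\<alpha> \<le> \<beta> \<longleftrightarrow> (Rep_omega1 \<alpha>, Rep_omega1 \<beta>) \<in> cardSuc natLeq"

definition less_omega1 :: "omega1 \<Rightarrow> omega1 \<Rightarrow> bool"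
  where "\<alpha> < \<beta> \<longleftrightarrow> \<alpha> \<le> \<beta> \<and> \<alpha> \<noteq> (\<beta> :: omega1)"

instance
proof -
  have wo: "Well_order (cardSuc natLeq)"
    using cardSuc_Card_order[OF natLeq_Card_order] card_order_on_def by blast
  then have refl: "refl_on (Field (cardSuc natLeq)) (cardSuc natLeq)"
    and tr: "trans (cardSuc natLeq)" and as: "antisym (cardSuc natLeq)"
    and tot: "total_on (Field (cardSuc natLeq)) (cardSuc natLeq)"
    and wf: "wf (cardSuc natLeq - Id)"
    by (auto simp: well_order_on_def linear_order_on_def partial_order_on_def preorder_on_def)
  have r: "\<alpha> \<le> \<alpha>" for \<alpha> :: omega1
    using refl Rep_omega1 by (auto simp: less_eq_omega1_def refl_on_def)
  have t: "\<alpha> \<le> \<gamma>" if "\<alpha> \<le> \<beta>" "\<beta> \<le> \<gamma>" for \<alpha> \<beta> \<gamma> :: omega1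
    using tr that unfolding less_eq_omega1_def by (meson transD)
  have a: "\<alpha> = \<beta>" if "\<alpha> \<le> \<beta>" "\<beta> \<le> \<alpha>" for \<alpha> \<beta> :: omega1
    using as that unfolding less_eq_omega1_def by (metis antisymD Rep_omega1_inject)
  have l: "\<alpha> \<le> \<beta> \<or> \<beta> \<le> \<alpha>" for \<alpha> \<beta> :: omega1
    using tot r Rep_omega1 Rep_omega1_inject
    unfolding less_eq_omega1_def total_on_def by metis
  have "wf (inv_image (cardSuc natLeq - Id) Rep_omega1)"
    using wf by (rule wf_inv_image)
  then have w: "wf {(\<alpha>, \<beta> :: omega1). \<alpha> < \<beta>}"
    by (rule wf_subset) (auto simp: inv_image_def less_omega1_def less_eq_omega1_def Rep_omega1_inject)
  show "OFCLASS(omega1, wellorder_class)"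
  proof (intro_classes)
    fix P :: "omega1 \<Rightarrow> bool" and \<alpha> :: omega1
    assume "\<And>x. (\<And>y. y < x \<Longrightarrow> P y) \<Longrightarrow> P x"
    then show "P \<alpha>" using wf_induct_rule[OF w, of P \<alpha>] by auto
  qed (use r t a l in \<open>auto simp: less_omega1_def\<close>)
qed

end

instantiation omega1 :: zero
begin
definition zero_omega1 :: omega1 where "zero_omega1 = (LEAST \<alpha>. True)"
instance ..
end

instance omega1 :: no_top
proof
  fix \<alpha> :: omega1
  have "infinite (Field (cardSuc natLeq))"
    using cardSuc_finite[OF natLeq_Card_order] Field_natLeq by simp
  then obtain b where "b \<in> Field (cardSuc natLeq)" "Rep_omega1 \<alpha> \<noteq> b"
      "(Rep_omega1 \<alpha>, b) \<in> cardSuc natLeq"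
    using infinite_Card_order_limit[OF cardSuc_Card_order[OF natLeq_Card_order]] Rep_omega1
    by meson
  then have "\<alpha> < Abs_omega1 b"
    by (auto simp: less_omega1_def less_eq_omega1_def Abs_omega1_inverse)
  then show "\<exists>\<beta>. \<alpha> < \<beta>" ..
qed

lemma countable_iff_card_of:
  includes cardinal_syntax
  shows "countable A \<longleftrightarrow> |A| \<le>o |UNIV :: nat set|"
  unfolding countable_def card_of_ordLeq[symmetric] by simp

lemma countable_lessThan_omega1: "countable {..< \<alpha> :: omega1}"
proof -
  include cardinal_syntax
  let ?r = "cardSuc natLeq"
  have "|underS ?r (Rep_omega1 \<alpha>)| <o ?r"
    using card_of_underS[OF cardSuc_Card_order[OF natLeq_Card_order]] Rep_omega1 by blast
  then have "|underS ?r (Rep_omega1 \<alpha>)| \<le>o natLeq"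
    using cardSuc_ordLeq_ordLess[OF natLeq_Card_order card_of_Card_order] by blast
  then have "|underS ?r (Rep_omega1 \<alpha>)| \<le>o |UNIV :: nat set|"
    using card_of_nat ordIso_symmetric ordLeq_ordIso_trans by blast
  then have "countable (underS ?r (Rep_omega1 \<alpha>))"
    by (simp add: countable_iff_card_of)
  moreover have "Rep_omega1 ` {..<\<alpha>} \<subseteq> underS ?r (Rep_omega1 \<alpha>)"
    by (auto simp: underS_def less_omega1_def less_eq_omega1_def Rep_omega1_inject)
  ultimately have "countable (Rep_omega1 ` {..<\<alpha>})"
    by (rule countable_subset[rotated])
  then show ?thesis
    by (rule countable_image_inj_on) (auto intro: inj_onI simp: Rep_omega1_inject)
qed

lemma uncountable_omega1: "uncountable (UNIV :: omega1 set)"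
proof
  include cardinal_syntax
  assume "countable (UNIV :: omega1 set)"
  then have "countable (Field (cardSuc natLeq))"
    using type_definition.Rep_range[OF type_definition_omega1] by (metis countable_image)
  then have "|Field (cardSuc natLeq)| \<le>o natLeq"
    using countable_iff_card_of card_of_nat ordLeq_ordIso_trans by blast
  moreover have "|Field (cardSuc natLeq)| =o cardSuc natLeq"
    by (rule card_of_Field_ordIso[OF cardSuc_Card_order[OF natLeq_Card_order]])
  ultimately have "cardSuc natLeq \<le>o natLeq"
    using ordIso_ordLeq_trans ordIso_symmetric by blast
  then show False
    using cardSuc_greater[OF natLeq_Card_order] not_ordLess_ordLeq by blast
qed

definition osuc :: "omega1 \<Rightarrow> omega1"
  where "osuc \<alpha> = (LEAST \<beta>. \<alpha> < \<beta>)"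

lemma less_osuc: "\<alpha> < osuc \<alpha>"
  unfolding osuc_def using gt_ex[of \<alpha>] by (rule LeastI_ex)

lemma less_osuc_iff: "\<beta> < osuc \<alpha> \<longleftrightarrow> \<beta> \<le> \<alpha>"
  by (metis less_osuc le_less_trans not_less not_less_Least osuc_def)

lemma osuc_inject [simp]: "osuc \<alpha> = osuc \<beta> \<longleftrightarrow> \<alpha> = \<beta>"
  by (metis less_osuc less_osuc_iff order.antisym)

lemma zero_le_omega1 [simp]: "(0 :: omega1) \<le> \<alpha>"
  unfolding zero_omega1_def by (rule Least_le) simp

lemma osuc_neq_zero [simp]: "osuc \<alpha> \<noteq> 0"
  using less_osuc[of \<alpha>] zero_le_omega1[of \<alpha>] by (metis not_less)

text \<open>Countable ordinals together with \<open>\<infinity>\<close>.\<close>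

datatype omega1_infty = Fin omega1 | Infty

instantiation omega1_infty :: linorder
begin

fun less_eq_omega1_infty :: "omega1_infty \<Rightarrow> omega1_infty \<Rightarrow> bool" where
  "x \<le> Infty \<longleftrightarrow> True"
| "Fin \<alpha> \<le> Fin \<beta> \<longleftrightarrow> \<alpha> \<le> \<beta>"
| "Infty \<le> Fin \<beta> \<longleftrightarrow> False"

definition less_omega1_infty :: "omega1_infty \<Rightarrow> omega1_infty \<Rightarrow> bool"
  where "x < y \<longleftrightarrow> x \<le> y \<and> \<not> y \<le> (x :: omega1_infty)"

instance
proof
  fix x y z :: omega1_infty
  show "x < y \<longleftrightarrow> x \<le> y \<and> \<not> y \<le> x" by (rule less_omega1_infty_def)
  show "x \<le> x" by (cases x) auto
  show "x \<le> z" if "x \<le> y" "y \<le> z" using that by (cases x; cases y; cases z) auto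
  show "x = y" if "x \<le> y" "y \<le> x" using that by (cases x; cases y) auto
  show "x \<le> y \<or> y \<le> x" by (cases x; cases y) auto
qed

end


section \<open>Baire space and problems\<close>

text \<open>The topology on \<open>nat \<Rightarrow> nat\<close> is the library's product of the discrete topologies.\<close>

type_synonym baire = "nat \<Rightarrow> nat"

definition initial_segment :: "nat list \<Rightarrow> baire \<Rightarrow> bool" (infix \<open>\<sqsubseteq>\<close> 50)
  where "\<sigma> \<sqsubseteq> x \<longleftrightarrow> (\<forall>i < length \<sigma>. \<sigma> ! i = x i)"

definition cylinder :: "nat list \<Rightarrow> baire set"
  where "cylinder \<sigma> = {x. \<sigma> \<sqsubseteq> x}"

text \<open>A value \<open>P p = Some S\<close> means that \<open>p\<close> is an instance with solution set \<open>S\<close>, which may be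
  empty; \<open>P p = None\<close> means that \<open>p\<close> is not an instance. The domain is \<open>dom P\<close>, and the
  restriction of \<open>P\<close> to \<open>A\<close> is \<open>P |` A\<close>.\<close>

type_synonym problem = "baire \<rightharpoonup> baire set"

definition solutions :: "problem \<Rightarrow> baire \<Rightarrow> baire set"
  where "solutions P p = the (P p)"

definition restrict_both :: "problem \<Rightarrow> baire set \<Rightarrow> baire set \<Rightarrow> problem"
  where "restrict_both P A B = (\<lambda>p. map_option (\<lambda>S. S \<inter> B) ((P |` A) p))"

definition continuous_problem :: "problem \<Rightarrow> bool"
  where "continuous_problem P \<longleftrightarrow>
    (\<exists>\<Phi> :: baire \<Rightarrow> baire. continuous_on (dom P) \<Phi> \<and> (\<forall>p \<in> dom P. \<Phi> p \<in> solutions P p))"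


section \<open>Cantor--Bendixson rank\<close>

definition cb_derivative :: "baire set \<Rightarrow> baire set"
  where "cb_derivative A = {p \<in> A. p islimpt A}"

text \<open>The three branches are the zero, successor and limit cases.\<close>

function iter_derivative :: "baire set \<Rightarrow> omega1 \<Rightarrow> baire set" where
  "iter_derivative A \<alpha> =
    (if \<alpha> = 0 then A
     else if \<exists>\<beta>. \<alpha> = osuc \<beta> then cb_derivative (iter_derivative A (THE \<beta>. \<alpha> = osuc \<beta>))
     else (\<Inter>\<beta> \<in> {..<\<alpha>}. iter_derivative A \<beta>))"
  by pat_completeness auto
termination
proof (relation "inv_image {(\<alpha>, \<beta>). \<alpha> < \<beta>} snd")
  show "wf (inv_image {(\<alpha> :: omega1, \<beta>). \<alpha> < \<beta>} (snd :: baire set \<times> omega1 \<Rightarrow> omega1))"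
    by (intro wf_inv_image wf)
qed (auto simp: less_osuc)

declare iter_derivative.simps [simp del]

lemma iter_derivative_zero: "iter_derivative A 0 = A"
  by (subst iter_derivative.simps) simp

lemma iter_derivative_osuc: "iter_derivative A (osuc \<alpha>) = cb_derivative (iter_derivative A \<alpha>)"
  by (subst iter_derivative.simps) simp

lemma iter_derivative_limit:
  "\<alpha> \<noteq> 0 \<Longrightarrow> (\<And>\<beta>. \<alpha> \<noteq> osuc \<beta>) \<Longrightarrow> iter_derivative A \<alpha> = (\<Inter>\<beta> \<in> {..<\<alpha>}. iter_derivative A \<beta>)"
  by (subst iter_derivative.simps) simp

text \<open>Countable ordinals suffice for ranks in Baire space: the iterated derivatives of \<open>A\<close> form a
  decreasing sequence of relatively closed subsets of the second countable space \<open>A\<close>, so they are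
  constant from some countable stage on, and the ranks are bounded below that stage.\<close>

definition cb_rank :: "baire set \<Rightarrow> baire \<Rightarrow> omega1_infty"
  where "cb_rank A p =
    (if \<exists>\<alpha>. p \<in> iter_derivative A \<alpha> - iter_derivative A (osuc \<alpha>)
     then Fin (THE \<alpha>. p \<in> iter_derivative A \<alpha> - iter_derivative A (osuc \<alpha>))
     else Infty)"

definition rankp :: "baire set \<Rightarrow> omega1_infty"
  where "rankp A =
    (if \<exists>\<alpha>. \<forall>p \<in> A. cb_rank A p \<le> Fin \<alpha>
     then Fin (LEAST \<alpha>. \<forall>p \<in> A. cb_rank A p \<le> Fin \<alpha>)
     else Infty)"


section \<open>The discontinuity game\<close>

text \<open>Positions of the game, named after the player to move and what that player has to choose:
  \<^item> \<open>One_instance \<alpha> P\<close>: Player 1 chooses an instance \<open>p\<close>; the rank-\<open>\<alpha>\<close> game for \<open>P\<close> begins;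
  \<^item> \<open>Two_solution \<alpha> P p\<close>: Player 2 chooses a solution \<open>q\<close> of \<open>p\<close>;
  \<^item> \<open>One_prefix \<alpha> P p q\<close>: Player 1 chooses an initial segment \<open>\<rho>\<close> of \<open>q\<close>;
  \<^item> \<open>Two_prefix \<alpha> P p \<rho>\<close>: Player 2 chooses an initial segment \<open>\<sigma>\<close> of \<open>p\<close>;
  \<^item> \<open>One_rank \<alpha> P \<sigma> \<rho>\<close>: Player 1 chooses some \<open>\<gamma> < \<alpha>\<close>.\<close>

datatype position =
    One_instance omega1 problem
  | Two_solution omega1 problem baire
  | One_prefix omega1 problem baire baire
  | Two_prefix omega1 problem baire "nat list"
  | One_rank omega1 problem "nat list" "nat list"

inductive legal_move :: "position \<Rightarrow> position \<Rightarrow> bool" where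
  "p \<in> dom P \<Longrightarrow> legal_move (One_instance \<alpha> P) (Two_solution \<alpha> P p)"
| "q \<in> solutions P p \<Longrightarrow> legal_move (Two_solution \<alpha> P p) (One_prefix \<alpha> P p q)"
| "\<alpha> \<noteq> 0 \<Longrightarrow> \<rho> \<sqsubseteq> q \<Longrightarrow> legal_move (One_prefix \<alpha> P p q) (Two_prefix \<alpha> P p \<rho>)"
| "\<sigma> \<sqsubseteq> p \<Longrightarrow> legal_move (Two_prefix \<alpha> P p \<rho>) (One_rank \<alpha> P \<sigma> \<rho>)"
| "\<gamma> < \<alpha> \<Longrightarrow> legal_move (One_rank \<alpha> P \<sigma> \<rho>)
     (One_instance \<gamma> (restrict_both P (cylinder \<sigma>) (cylinder \<rho>)))"

definition terminal :: "position \<Rightarrow> bool"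
  where "terminal v \<longleftrightarrow> (\<nexists>w. legal_move v w)"

fun two_to_move :: "position \<Rightarrow> bool" where
  "two_to_move (Two_solution \<alpha> P p) \<longleftrightarrow> True"
| "two_to_move (Two_prefix \<alpha> P p \<rho>) \<longleftrightarrow> True"
| "two_to_move _ \<longleftrightarrow> False"

text \<open>The winner at a terminal position. Player 1 wins at \<open>Two_solution \<alpha> P p\<close> when \<open>p\<close> has no
  solution, and Player 2 wins at \<open>One_prefix \<alpha> P p q\<close> when \<open>\<alpha> = 0\<close>. The only other reachable
  terminal positions are \<open>One_instance \<alpha> P\<close> with \<open>dom P = {}\<close>, which can arise only as the initial position
  of the whole game; there Player 1 is unable to make the first move and Player 2 wins.\<close>

fun won_by_two :: "position \<Rightarrow> bool" where
  "won_by_two (One_instance \<alpha> P) \<longleftrightarrow> dom P = {}"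
| "won_by_two (One_prefix \<alpha> P p q) \<longleftrightarrow> \<alpha> = 0"
| "won_by_two _ \<longleftrightarrow> False"

text \<open>Partial plays are nonempty lists of positions in chronological order. A strategy for Player 2
  maps each partial play at whose end Player 2 has to move to the next position. All plays are
  finite, because the rank strictly decreases from one round to the next.\<close>

inductive partial_play :: "position \<Rightarrow> position list \<Rightarrow> bool" for v where
  "partial_play v [v]"
| "partial_play v h \<Longrightarrow> legal_move (last h) w \<Longrightarrow> partial_play v (h @ [w])"

type_synonym strategy = "position list \<Rightarrow> position"

definition strategy_for_two :: "position \<Rightarrow> strategy \<Rightarrow> bool"
  where "strategy_for_two v \<tau> \<longleftrightarrow>
    (\<forall>h. partial_play v h \<and> two_to_move (last h) \<and> \<not> terminal (last h)
       \<longrightarrow> legal_move (last h) (\<tau> h))"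

definition follows :: "position list \<Rightarrow> strategy \<Rightarrow> bool"
  where "follows h \<tau> \<longleftrightarrow>
    (\<forall>i. Suc i < length h \<and> two_to_move (h ! i) \<longrightarrow> h ! Suc i = \<tau> (take (Suc i) h))"

definition winning_strategy_for_two :: "position \<Rightarrow> strategy \<Rightarrow> bool"
  where "winning_strategy_for_two v \<tau> \<longleftrightarrow> strategy_for_two v \<tau> \<and>
    (\<forall>h. partial_play v h \<and> follows h \<tau> \<and> terminal (last h) \<longrightarrow> won_by_two (last h))"

definition player2_has_winning_strategy :: "omega1 \<Rightarrow> problem \<Rightarrow> bool"
  where "player2_has_winning_strategy \<alpha> P \<longleftrightarrow>
    (\<exists>\<tau>. winning_strategy_for_two (One_instance \<alpha> P) \<tau>)"

end

theory Submission
  imports Defs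
begin

text \<open>
  The strategy of Player 2 is turned into a continuous selection by induction on the rank of the
  game. It is enough to find a selection near each point \<open>p\<close> of the domain \<open>D = dom P \<inter> A\<close>: Baire space is
  zero-dimensional, so local selections can be pasted along a partition into clopen pieces
  (\<open>has_selection_locally\<close>).

  Fix \<open>p\<close>. Near \<open>p\<close>, every other point of \<open>D\<close> has smaller Cantor--Bendixson rank than \<open>p\<close>. Let
  Player 1 play \<open>p\<close>, and let \<open>q\<close> be Player 2's reply; \<open>q\<close> becomes the value of the selection at \<open>p\<close>. For
  continuity at \<open>p\<close>, values at points close to \<open>p\<close> must be close to \<open>q\<close>. So let Player 1 play
  \<open>\<rho> = q\<restriction>k\<close>, and let \<open>\<sigma>\<close> be Player 2's reply. A point \<open>x \<noteq> p\<close> of \<open>D\<close> in the cylinder of \<open>\<sigma>\<close> and close to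
  \<open>p\<close> has some rank \<open>\<gamma>\<close> below that of \<open>p\<close>, hence below \<open>\<alpha>\<close>, and near \<open>x\<close> all ranks are at most \<open>\<gamma>\<close>.
  Player 1 may thus choose this \<open>\<gamma>\<close>, and the induction hypothesis for the restricted problem
  gives a selection near \<open>x\<close> whose values extend \<open>q\<restriction>k\<close>. Pasting these gives, for each \<open>k\<close>, a selection on a
  punctured neighbourhood of \<open>p\<close> with values extending \<open>q\<restriction>k\<close>. Finally the selections for
  different \<open>k\<close> are put together along the clopen rings around \<open>p\<close>, with \<open>k\<close> growing as the rings
  shrink to \<open>p\<close> (\<open>has_selection_around_point\<close>).

  The order of moves matters: Player 2 commits to \<open>\<sigma>\<close> before \<open>\<gamma>\<close> is chosen, which is why one \<open>\<sigma>\<close> serves points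
  \<open>x\<close> of different ranks.
\<close>

section \<open>Basic neighbourhoods in Baire space\<close>

definition nbhd :: "baire \<Rightarrow> nat \<Rightarrow> baire set"
  where "nbhd x n = {y. \<forall>i<n. y i = x i}"

lemma nbhd_refl [simp]: "x \<in> nbhd x n"
  by (simp add: nbhd_def)

lemma nbhd_antimono: "m \<le> n \<Longrightarrow> nbhd x n \<subseteq> nbhd x m"
  by (auto simp: nbhd_def)

lemma nbhd_eq: "y \<in> nbhd x n \<Longrightarrow> m \<le> n \<Longrightarrow> nbhd y m = nbhd x m"
  by (auto simp: nbhd_def)

lemma cylinder_eq_nbhd: "\<sigma> \<sqsubseteq> x \<Longrightarrow> cylinder \<sigma> = nbhd x (length \<sigma>)"
  by (auto simp: cylinder_def nbhd_def initial_segment_def)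

lemma map_upt_initial_segment: "map x [0..<n] \<sqsubseteq> x"
  by (simp add: initial_segment_def)

lemma open_nbhd: "open (nbhd x n)"
proof -
  have "open (Pi\<^sub>E UNIV (\<lambda>i. if i < n then {x i} else UNIV))"
    by (rule open_PiE) (auto intro: open_discrete finite_subset[of _ "{..<n}"])
  also have "Pi\<^sub>E UNIV (\<lambda>i. if i < n then {x i} else UNIV) = nbhd x n"
    by (auto simp: nbhd_def PiE_def Pi_def split: if_splits)
  finally show ?thesis .
qed

lemma open_contains_nbhd:
  assumes "open U" "x \<in> U"
  obtains n where "nbhd x n \<subseteq> U"
proof -
  obtain X where X: "x \<in> Pi\<^sub>E UNIV X" "finite {i. X i \<noteq> UNIV}" "Pi\<^sub>E UNIV X \<subseteq> U"
    using product_topology_open_contains_basis[of "\<lambda>_. euclidean" UNIV U x] assms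
    by (auto simp: open_fun_def)
  obtain n where n: "\<And>i. X i \<noteq> UNIV \<Longrightarrow> i < n"
    using X(2) unfolding finite_nat_set_iff_bounded by blast
  have "nbhd x n \<subseteq> Pi\<^sub>E UNIV X"
  proof (clarsimp simp: PiE_def Pi_def)
    fix y i assume "y \<in> nbhd x n"
    then show "y i \<in> X i"
      using X(1) n[of i] by (cases "X i = UNIV") (auto simp: nbhd_def PiE_def Pi_def)
  qed
  with X(3) show ?thesis by (blast intro: that)
qed

text \<open>Continuity in the form used below: every finite part of the value depends only on a finite
  part of the argument, so that no open sets need to be mentioned.\<close>

lemma continuous_on_nbhd:
  fixes f :: "baire \<Rightarrow> baire"
  shows "continuous_on D f \<longleftrightarrow>
    (\<forall>x\<in>D. \<forall>k. \<exists>n. \<forall>y\<in>D \<inter> nbhd x n. f y \<in> nbhd (f x) k)"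
proof
  assume c: "continuous_on D f"
  show "\<forall>x\<in>D. \<forall>k. \<exists>n. \<forall>y\<in>D \<inter> nbhd x n. f y \<in> nbhd (f x) k"
  proof (intro ballI allI)
    fix x k assume "x \<in> D"
    then obtain A where A: "open A" "x \<in> A" "\<forall>y\<in>D. y \<in> A \<longrightarrow> f y \<in> nbhd (f x) k"
      using c open_nbhd nbhd_refl unfolding continuous_on_topological by metis
    then obtain n where "nbhd x n \<subseteq> A" by (elim open_contains_nbhd)
    with A(3) show "\<exists>n. \<forall>y\<in>D \<inter> nbhd x n. f y \<in> nbhd (f x) k" by blast
  qed
next
  assume r: "\<forall>x\<in>D. \<forall>k. \<exists>n. \<forall>y\<in>D \<inter> nbhd x n. f y \<in> nbhd (f x) k"
  show "continuous_on D f"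
    unfolding continuous_on_topological
  proof (intro ballI allI impI)
    fix x B assume "x \<in> D" "open B" "f x \<in> B"
    then obtain k where "nbhd (f x) k \<subseteq> B" by (elim open_contains_nbhd)
    moreover obtain n where "\<forall>y\<in>D \<inter> nbhd x n. f y \<in> nbhd (f x) k"
      using r \<open>x \<in> D\<close> by blast
    ultimately show "\<exists>A. open A \<and> x \<in> A \<and> (\<forall>y\<in>D. y \<in> A \<longrightarrow> f y \<in> B)"
      using open_nbhd[of x n] nbhd_refl[of x n] by blast
  qed
qed

section \<open>Continuous selections\<close>

definition has_selection :: "baire set \<Rightarrow> (baire \<Rightarrow> baire set) \<Rightarrow> bool"
  where "has_selection D S \<longleftrightarrow> (\<exists>\<Phi>. continuous_on D \<Phi> \<and> (\<forall>x\<in>D. \<Phi> x \<in> S x))"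

lemma has_selection_mono:
  assumes "has_selection D S" "\<And>x. x \<in> D \<Longrightarrow> S x \<subseteq> T x"
  shows "has_selection D T"
  using assms unfolding has_selection_def by blast

text \<open>Two basic neighbourhoods are nested or disjoint. If each \<open>x\<close> is assigned the largest basic
  neighbourhood \<open>nbhd x (N x)\<close> of its own that admits a selection, then any two of these
  neighbourhoods are equal or disjoint. They form a clopen partition, and selections chosen
  independently on the pieces paste to a continuous function.\<close>

lemma has_selection_locally:
  assumes "\<And>x. x \<in> D \<Longrightarrow> \<exists>n. has_selection (D \<inter> nbhd x n) S"
  shows "has_selection D S"
proof -
  define N where "N x = (LEAST n. has_selection (D \<inter> nbhd x n) S)" for x
  have sel: "has_selection (D \<inter> nbhd x (N x)) S" if "x \<in> D" for x
    unfolding N_def using assms[OF that] by (rule LeastI_ex)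
  have N_eq: "N y = N x" if "x \<in> D" "y \<in> nbhd x (N x)" for x y
  proof (rule antisym)
    show le: "N y \<le> N x"
      unfolding N_def[of y]
      by (rule Least_le) (use sel[OF that(1)] nbhd_eq[OF that(2)] in simp)
    have "has_selection (D \<inter> nbhd y (N y)) S"
      unfolding N_def[of y]
      by (rule LeastI[of _ "N x"]) (use sel[OF that(1)] nbhd_eq[OF that(2)] in simp)
    then show "N x \<le> N y"
      unfolding N_def[of x]
      by (intro Least_le) (simp add: nbhd_eq[OF that(2) le])
  qed
  \<comment> \<open>The choice depends on the set \<open>E\<close> alone, so all points of one piece use the same selection.\<close>
  define F where "F E = (SOME \<Phi>. continuous_on E \<Phi> \<and> (\<forall>x\<in>E. \<Phi> x \<in> S x))" for E
  have F: "continuous_on E (F E) \<and> (\<forall>x\<in>E. F E x \<in> S x)" if "has_selection E S" for E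
    unfolding F_def using that unfolding has_selection_def by (rule someI_ex)
  define \<Phi> where "\<Phi> x = F (D \<inter> nbhd x (N x)) x" for x
  have "continuous_on D \<Phi>"
    unfolding continuous_on_nbhd
  proof (intro ballI allI)
    fix x k assume x: "x \<in> D"
    let ?E = "D \<inter> nbhd x (N x)"
    obtain n where n: "\<forall>y\<in>?E \<inter> nbhd x n. F ?E y \<in> nbhd (F ?E x) k"
      using F[OF sel[OF x]] x unfolding continuous_on_nbhd by (meson IntI nbhd_refl)
    have "\<Phi> y \<in> nbhd (\<Phi> x) k" if "y \<in> D \<inter> nbhd x (max n (N x))" for y
    proof -
      have y: "y \<in> nbhd x (N x)" "y \<in> nbhd x n"
        using that nbhd_antimono[of n "max n (N x)" x] nbhd_antimono[of "N x" "max n (N x)" x]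
        by auto
      have "nbhd y (N y) = nbhd x (N x)"
        using N_eq[OF x y(1)] nbhd_eq[OF y(1)] by simp
      then show ?thesis using n that y by (simp add: \<Phi>_def)
    qed
    then show "\<exists>n. \<forall>y\<in>D \<inter> nbhd x n. \<Phi> y \<in> nbhd (\<Phi> x) k" by blast
  qed
  moreover have "\<Phi> x \<in> S x" if "x \<in> D" for x
    using F[OF sel[OF that]] that by (simp add: \<Phi>_def)
  ultimately show ?thesis unfolding has_selection_def by blast
qed

text \<open>The points other than \<open>p\<close> fall into clopen rings according to the first place \<open>\<delta> x\<close> where they
  differ from \<open>p\<close>. On each ring it is safe to use a single one of the given selections; taking the
  one with the largest permitted \<open>k\<close> makes \<open>k\<close> tend to infinity as the rings approach \<open>p\<close>, and so the
  value \<open>q\<close> at \<open>p\<close> extends the selection continuously.\<close>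

lemma has_selection_around_point:
  assumes q: "q \<in> S p"
    and punctured: "\<And>k. \<exists>s. has_selection (D \<inter> nbhd p s - {p}) (\<lambda>x. S x \<inter> nbhd q k)"
  shows "\<exists>n. has_selection (D \<inter> nbhd p n) S"
proof -
  obtain s where s: "\<And>k. has_selection (D \<inter> nbhd p (s k) - {p}) (\<lambda>x. S x \<inter> nbhd q k)"
    using punctured by metis
  obtain F where F: "\<And>k. continuous_on (D \<inter> nbhd p (s k) - {p}) (F k)"
    "\<And>k x. x \<in> D \<inter> nbhd p (s k) - {p} \<Longrightarrow> F k x \<in> S x \<inter> nbhd q k"
    using s unfolding has_selection_def by metis
  define \<delta> where "\<delta> x = (LEAST i. x i \<noteq> p i)" for x
  have \<delta>_less: "x i = p i" if "i < \<delta> x" for x i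
    using that not_less_Least unfolding \<delta>_def by blast
  have \<delta>_neq: "x (\<delta> x) \<noteq> p (\<delta> x)" if "x \<noteq> p" for x
    unfolding \<delta>_def using LeastI_ex[of "\<lambda>i. x i \<noteq> p i"] that by blast
  have \<delta>_nbhd: "x \<in> nbhd p n \<longleftrightarrow> n \<le> \<delta> x" if "x \<noteq> p" for x n
    using \<delta>_less[of _ x] \<delta>_neq[OF that] by (auto simp: nbhd_def) (meson not_less)
  have \<delta>_eq: "\<delta> y = \<delta> x" "y \<noteq> p" if "x \<noteq> p" "y \<in> nbhd x (Suc (\<delta> x))" for x y
  proof -
    have *: "y i = x i" if "i \<le> \<delta> x" for i
      using \<open>y \<in> nbhd x (Suc (\<delta> x))\<close> that by (simp add: nbhd_def)
    then show "y \<noteq> p" using \<delta>_neq[OF \<open>x \<noteq> p\<close>] by auto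
    show "\<delta> y = \<delta> x"
      unfolding \<delta>_def[of y]
    proof (rule Least_equality)
      show "y (\<delta> x) \<noteq> p (\<delta> x)" using * \<delta>_neq[OF \<open>x \<noteq> p\<close>] by simp
      show "\<delta> x \<le> i" if "y i \<noteq> p i" for i
        using that * \<delta>_less[of i x] by (metis le_cases not_less)
    qed
  qed
  \<comment> \<open>The ring at \<open>l\<close> lies in the domain of \<open>F k\<close> if \<open>s k \<le> l\<close>. The bound \<open>k \<le> l\<close> only ensures that
    the maximum exists, as infinitely many \<open>k\<close> can satisfy \<open>s k \<le> l\<close>.\<close>
  define K where "K l = Max {k. k \<le> l \<and> s k \<le> l}" for l
  have finK: "finite {k. k \<le> l \<and> s k \<le> l}" for l
    by (rule finite_subset[of _ "{..l}"]) auto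
  have sK: "s (K l) \<le> l" if "s 0 \<le> l" for l
    using Max_in[OF finK[of l]] that unfolding K_def by blast
  have K_ge: "k \<le> K l" if "k \<le> l" "s k \<le> l" for k l
    unfolding K_def using that finK by (intro Max_ge) auto
  define \<Phi> where "\<Phi> x = (if x = p then q else F (K (\<delta> x)) x)" for x
  let ?E = "D \<inter> nbhd p (s 0)"
  have inK: "x \<in> D \<inter> nbhd p (s (K (\<delta> x))) - {p}" if "x \<in> ?E" "x \<noteq> p" for x
    using that sK[of "\<delta> x"] by (auto simp: \<delta>_nbhd)
  have "continuous_on ?E \<Phi>"
    unfolding continuous_on_nbhd
  proof (intro ballI allI)
    fix x k assume x: "x \<in> ?E"
    show "\<exists>n. \<forall>y\<in>?E \<inter> nbhd x n. \<Phi> y \<in> nbhd (\<Phi> x) k"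
    proof (cases "x = p")
      case True
      have "\<Phi> y \<in> nbhd q k" if y: "y \<in> ?E" "y \<in> nbhd p (max k (s k))" for y
      proof (cases "y = p")
        case False
        then have "k \<le> K (\<delta> y)" using y(2) K_ge by (simp add: \<delta>_nbhd)
        moreover have "\<Phi> y \<in> nbhd q (K (\<delta> y))"
          using F(2)[OF inK[OF y(1) False]] False by (simp add: \<Phi>_def)
        ultimately show ?thesis using nbhd_antimono by blast
      qed (simp add: \<Phi>_def)
      then show ?thesis using True by (auto simp: \<Phi>_def[of p])
    next
      case False
      let ?k = "K (\<delta> x)"
      obtain n where n: "\<forall>y\<in>(D \<inter> nbhd p (s ?k) - {p}) \<inter> nbhd x n. F ?k y \<in> nbhd (F ?k x) k"
        using F(1)[of ?k] inK[OF x False] unfolding continuous_on_nbhd by meson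
      have "\<Phi> y \<in> nbhd (\<Phi> x) k" if y: "y \<in> ?E" "y \<in> nbhd x (max n (Suc (\<delta> x)))" for y
      proof -
        have y': "y \<in> nbhd x n" "y \<in> nbhd x (Suc (\<delta> x))"
          using y(2) nbhd_antimono max.cobounded1 max.cobounded2 by blast+
        note eq = \<delta>_eq[OF False y'(2)]
        show ?thesis
          using n inK[OF y(1) eq(2)] y'(1) False eq by (simp add: \<Phi>_def)
      qed
      then show ?thesis by blast
    qed
  qed
  moreover have "\<Phi> x \<in> S x" if "x \<in> ?E" for x
    using F(2)[OF inK[OF that]] q by (auto simp: \<Phi>_def)
  ultimately show ?thesis unfolding has_selection_def by blast
qed

section \<open>The Cantor--Bendixson rank drops near a point\<close>

text \<open>The only feature of the rank needed for the selection. Unlike the rank itself, which can change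
  when it is computed in a smaller set, a function with this property keeps it on subsets.\<close>

definition locally_max_rank :: "(baire \<Rightarrow> omega1) \<Rightarrow> baire set \<Rightarrow> bool"
  where "locally_max_rank r D \<longleftrightarrow> (\<forall>p\<in>D. \<exists>n. \<forall>x\<in>D \<inter> nbhd p n - {p}. r x < r p)"

lemma locally_max_rank_subset:
  "locally_max_rank r D \<Longrightarrow> E \<subseteq> D \<Longrightarrow> locally_max_rank r E"
  unfolding locally_max_rank_def by fast

lemma iter_derivative_antimono:
  "\<beta> \<le> \<alpha> \<Longrightarrow> iter_derivative A \<alpha> \<subseteq> iter_derivative A \<beta>"
proof (induction \<alpha> rule: less_induct)
  case (less \<alpha>)
  show ?case
  proof (cases "\<beta> = \<alpha>")
    case False
    then have lt: "\<beta> < \<alpha>" using less.prems by simp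
    show ?thesis
    proof (cases "\<exists>\<delta>. \<alpha> = osuc \<delta>")
      case True
      then obtain \<delta> where \<delta>: "\<alpha> = osuc \<delta>" ..
      then have "iter_derivative A \<delta> \<subseteq> iter_derivative A \<beta>"
        using lt less.IH[of \<delta>] less_osuc less_osuc_iff by blast
      then show ?thesis by (auto simp: \<delta> iter_derivative_osuc cb_derivative_def)
    next
      case limit: False
      have "\<alpha> \<noteq> 0" using lt zero_le_omega1[of \<beta>] by (metis not_less)
      then show ?thesis using limit lt by (auto simp: iter_derivative_limit)
    qed
  qed simp
qed

text \<open>The derivatives decrease, so a point leaves them at one stage only.\<close>

lemma cb_rank_stage:
  assumes "p \<in> iter_derivative A \<alpha>" "p \<notin> iter_derivative A (osuc \<alpha>)"
  shows "cb_rank A p = Fin \<alpha>"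
proof -
  have "\<beta> = \<alpha>" if "p \<in> iter_derivative A \<beta> - iter_derivative A (osuc \<beta>)" for \<beta>
  proof (rule ccontr)
    assume "\<beta> \<noteq> \<alpha>"
    then consider "osuc \<beta> \<le> \<alpha>" | "osuc \<alpha> \<le> \<beta>"
      using less_osuc_iff by (metis not_less order.antisym)
    then show False
      using that assms iter_derivative_antimono by cases blast+
  qed
  then have "(THE \<beta>. p \<in> iter_derivative A \<beta> - iter_derivative A (osuc \<beta>)) = \<alpha>"
    using assms by blast
  then show ?thesis using assms unfolding cb_rank_def by auto
qed

text \<open>If \<open>p\<close> leaves the derivatives right after stage \<open>r p\<close>, it is isolated in that stage. The other
  points of \<open>A\<close> near \<open>p\<close> are therefore missing from stage \<open>r p\<close>: they left earlier.\<close>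

lemma rankp_le_imp_rank_function:
  assumes "rankp A \<le> Fin \<alpha>"
  obtains r where "locally_max_rank r A" "\<And>p. p \<in> A \<Longrightarrow> r p \<le> \<alpha>"
proof -
  have ex: "\<exists>\<beta>. \<forall>p\<in>A. cb_rank A p \<le> Fin \<beta>"
    using assms by (auto simp: rankp_def split: if_splits)
  then have "(LEAST \<beta>. \<forall>p\<in>A. cb_rank A p \<le> Fin \<beta>) \<le> \<alpha>"
    using assms by (simp add: rankp_def)
  then have le: "cb_rank A p \<le> Fin \<alpha>" if "p \<in> A" for p
    using LeastI_ex[OF ex] that by (meson less_eq_omega1_infty.simps(2) order_trans)
  have "\<exists>\<beta>\<le>\<alpha>. p \<in> iter_derivative A \<beta> - iter_derivative A (osuc \<beta>)" if p: "p \<in> A" for p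
  proof -
    obtain \<beta> where \<beta>: "p \<in> iter_derivative A \<beta> - iter_derivative A (osuc \<beta>)"
      using le[OF p] by (auto simp: cb_rank_def split: if_splits)
    then have "\<beta> \<le> \<alpha>"
      using le[OF p] cb_rank_stage[of p A \<beta>] by simp
    with \<beta> show ?thesis by blast
  qed
  then obtain r where r: "\<And>p. p \<in> A \<Longrightarrow> r p \<le> \<alpha>"
      "\<And>p. p \<in> A \<Longrightarrow> p \<in> iter_derivative A (r p)"
      "\<And>p. p \<in> A \<Longrightarrow> p \<notin> iter_derivative A (osuc (r p))"
    by (metis DiffE)
  have "locally_max_rank r A"
    unfolding locally_max_rank_def
  proof
    fix p assume p: "p \<in> A"
    then have "\<not> p islimpt iter_derivative A (r p)"
      using r(2,3)[OF p] by (auto simp: iter_derivative_osuc cb_derivative_def)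
    then obtain U where U: "p \<in> U" "open U" "\<And>x. x \<in> iter_derivative A (r p) \<Longrightarrow> x \<in> U \<Longrightarrow> x = p"
      unfolding islimpt_def by blast
    then obtain n where n: "nbhd p n \<subseteq> U" by (elim open_contains_nbhd)
    have "r x < r p" if "x \<in> A \<inter> nbhd p n - {p}" for x
    proof (rule ccontr)
      assume "\<not> r x < r p"
      then have "x \<in> iter_derivative A (r p)"
        using r(2)[of x] that iter_derivative_antimono[of "r p" "r x" A] by (auto simp: not_less)
      then show False using U(3) n that by blast
    qed
    then show "\<exists>n. \<forall>x\<in>A \<inter> nbhd p n - {p}. r x < r p" by blast
  qed
  with r(1) show ?thesis by (blast intro: that)
qed

section \<open>Unfolding winning strategies\<close>

text \<open>One full round of the game, without histories. The case \<open>\<alpha> = 0\<close>, where the game ends after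
  Player 2's solution, needs no clause of its own: there is no \<open>\<gamma> < 0\<close>, and any \<open>\<sigma> \<sqsubseteq> p\<close> will do.\<close>

inductive two_wins :: "omega1 \<Rightarrow> problem \<Rightarrow> bool" where
  two_winsI: "(\<And>p. p \<in> dom P \<Longrightarrow> \<exists>q\<in>solutions P p. \<forall>\<rho>. \<rho> \<sqsubseteq> q \<longrightarrow>
      (\<exists>\<sigma>. \<sigma> \<sqsubseteq> p \<and> (\<forall>\<gamma><\<alpha>. two_wins \<gamma> (restrict_both P (cylinder \<sigma>) (cylinder \<rho>)))))
    \<Longrightarrow> two_wins \<alpha> P"

lemma follows_snoc:
  assumes "follows h \<tau>" "h \<noteq> []" "two_to_move (last h) \<Longrightarrow> w = \<tau> h"
  shows "follows (h @ [w]) \<tau>"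
  unfolding follows_def
proof (intro allI impI)
  fix i assume i: "Suc i < length (h @ [w]) \<and> two_to_move ((h @ [w]) ! i)"
  show "(h @ [w]) ! Suc i = \<tau> (take (Suc i) (h @ [w]))"
  proof (cases "Suc i < length h")
    case True
    then show ?thesis using i assms(1) by (simp add: follows_def nth_append)
  next
    case False
    then have "Suc i = length h" using i by simp
    then have "i = length h - 1" by simp
    then show ?thesis using i assms(2,3) \<open>Suc i = length h\<close>
      by (simp add: nth_append last_conv_nth)
  qed
qed

text \<open>A strategy consults the whole history, whereas \<open>two_wins\<close> speaks of positions. The induction
  therefore ranges over all plays \<open>h\<close> that follow the strategy and have arrived at a new round.
  Nonemptiness of the solution sets comes from the winning condition, the legality of the replies
  from \<open>\<tau>\<close> being a strategy.\<close>

lemma winning_strategy_imp_two_wins: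
  assumes win: "winning_strategy_for_two v \<tau>"
    and "partial_play v h" "follows h \<tau>" "last h = One_instance \<alpha> P"
  shows "two_wins \<alpha> P"
  using assms(2-)
proof (induction \<alpha> arbitrary: h P rule: less_induct)
  case (less \<alpha>)
  define reached where "reached w \<longleftrightarrow> (\<exists>h. partial_play v h \<and> follows h \<tau> \<and> last h = w)" for w
  have nonempty: "h \<noteq> []" if "partial_play v h" for h
    using that by cases auto
  have one: "reached w'" if "reached w" "\<not> two_to_move w" "legal_move w w'" for w w'
    using that partial_play.intros(2) follows_snoc nonempty unfolding reached_def
    by (metis last_snoc)
  have two: "\<exists>w'. legal_move w w' \<and> reached w'"
    if w: "reached w" "two_to_move w" "\<not> terminal w" for w
  proof -
    obtain h where h: "partial_play v h" "follows h \<tau>" "last h = w"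
      using w(1) unfolding reached_def by blast
    then have "legal_move w (\<tau> h)"
      using win w unfolding winning_strategy_for_two_def strategy_for_two_def by blast
    then show ?thesis
      using h partial_play.intros(2) follows_snoc nonempty unfolding reached_def
      by (metis last_snoc)
  qed
  have start: "reached (One_instance \<alpha> P)"
    using less.prems unfolding reached_def by blast
  show ?case
  proof (rule two_winsI)
    fix p assume "p \<in> dom P"
    then have "reached (Two_solution \<alpha> P p)"
      using one[OF start] legal_move.intros(1) by simp
    moreover from this have "\<not> terminal (Two_solution \<alpha> P p)"
      using win unfolding reached_def winning_strategy_for_two_def by fastforce
    ultimately obtain w' where "legal_move (Two_solution \<alpha> P p) w'" "reached w'"
      using two by fastforce
    then obtain q where q: "q \<in> solutions P p" "reached (One_prefix \<alpha> P p q)"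
      by (auto elim: legal_move.cases)
    have "\<exists>\<sigma>. \<sigma> \<sqsubseteq> p \<and> (\<forall>\<gamma><\<alpha>. two_wins \<gamma> (restrict_both P (cylinder \<sigma>) (cylinder \<rho>)))"
      if \<rho>: "\<rho> \<sqsubseteq> q" for \<rho>
    proof (cases "\<alpha> = 0")
      case True
      have "[] \<sqsubseteq> p" by (simp add: initial_segment_def)
      moreover have "\<not> \<gamma> < \<alpha>" for \<gamma> using True zero_le_omega1[of \<gamma>] by (metis not_less)
      ultimately show ?thesis by blast
    next
      case False
      have "reached (Two_prefix \<alpha> P p \<rho>)"
        using one[OF q(2)] legal_move.intros(3)[OF False \<rho>] by simp
      moreover have "\<not> terminal (Two_prefix \<alpha> P p \<rho>)"
        unfolding terminal_def using legal_move.intros(4)[of "[]" p] by (auto simp: initial_segment_def)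
      ultimately obtain w' where "legal_move (Two_prefix \<alpha> P p \<rho>) w'" "reached w'"
        using two by fastforce
      then obtain \<sigma> where \<sigma>: "\<sigma> \<sqsubseteq> p" "reached (One_rank \<alpha> P \<sigma> \<rho>)"
        by (auto elim: legal_move.cases)
      have "two_wins \<gamma> (restrict_both P (cylinder \<sigma>) (cylinder \<rho>))" if "\<gamma> < \<alpha>" for \<gamma>
        using one[OF \<sigma>(2)] legal_move.intros(5)[OF that] less.IH[OF that]
        unfolding reached_def by (metis two_to_move.simps(5))
      with \<sigma>(1) show ?thesis by blast
    qed
    with q(1) show "\<exists>q\<in>solutions P p. \<forall>\<rho>. \<rho> \<sqsubseteq> q \<longrightarrow>
      (\<exists>\<sigma>. \<sigma> \<sqsubseteq> p \<and> (\<forall>\<gamma><\<alpha>. two_wins \<gamma> (restrict_both P (cylinder \<sigma>) (cylinder \<rho>))))"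
      by blast
  qed
qed

corollary player2_has_winning_strategy_imp_two_wins:
  assumes "player2_has_winning_strategy \<alpha> P"
  shows "two_wins \<alpha> P"
proof -
  obtain \<tau> where "winning_strategy_for_two (One_instance \<alpha> P) \<tau>"
    using assms unfolding player2_has_winning_strategy_def by blast
  then show ?thesis
    by (rule winning_strategy_imp_two_wins[OF _ partial_play.intros(1)]) (simp_all add: follows_def)
qed

section \<open>Selections from winning positions\<close>

lemma dom_restrict_both: "dom (restrict_both P A B) = dom P \<inter> A"
  by (auto simp: restrict_both_def dom_def restrict_map_def split: if_splits)

lemma solutions_restrict_both:
  "p \<in> dom P \<Longrightarrow> p \<in> A \<Longrightarrow> solutions (restrict_both P A B) p = solutions P p \<inter> B"
  by (auto simp: restrict_both_def solutions_def)

text \<open>The induction described at the beginning. Its statement is about an arbitrary \<open>D\<close> with a rank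
  function because it is applied to the pieces of a punctured neighbourhood of \<open>p\<close>; all of them use
  the same function \<open>r\<close>.\<close>

lemma two_wins_imp_has_selection:
  assumes "two_wins \<alpha> P" "D \<subseteq> dom P" "locally_max_rank r D" "\<And>x. x \<in> D \<Longrightarrow> r x \<le> \<alpha>"
  shows "has_selection D (solutions P)"
  using assms
proof (induction \<alpha> P arbitrary: D rule: two_wins.induct)
  case (two_winsI P \<alpha>)
  show ?case
  proof (rule has_selection_locally)
    fix p assume p: "p \<in> D"
    obtain n where n: "\<And>x. x \<in> D \<inter> nbhd p n - {p} \<Longrightarrow> r x < r p"
      using two_winsI.prems(2) p unfolding locally_max_rank_def by blast
    \<comment> \<open>\<open>?Q\<close> is \<open>two_wins\<close> together with the induction hypothesis.\<close>
    let ?Q = "\<lambda>\<gamma> R. two_wins \<gamma> R \<and> (\<forall>E. E \<subseteq> dom R \<longrightarrow> locally_max_rank r E \<longrightarrow>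
      (\<forall>x. x \<in> E \<longrightarrow> r x \<le> \<gamma>) \<longrightarrow> has_selection E (solutions R))"
    have "\<exists>q\<in>solutions P p. \<forall>\<rho>. \<rho> \<sqsubseteq> q \<longrightarrow>
        (\<exists>\<sigma>. \<sigma> \<sqsubseteq> p \<and> (\<forall>\<gamma><\<alpha>. ?Q \<gamma> (restrict_both P (cylinder \<sigma>) (cylinder \<rho>))))"
      using p two_winsI.prems(1) by (intro two_winsI.IH) auto
    then obtain q where q: "q \<in> solutions P p" and answer: "\<And>\<rho>. \<rho> \<sqsubseteq> q \<Longrightarrow>
        \<exists>\<sigma>. \<sigma> \<sqsubseteq> p \<and> (\<forall>\<gamma><\<alpha>. ?Q \<gamma> (restrict_both P (cylinder \<sigma>) (cylinder \<rho>)))"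
      by blast
    show "\<exists>n. has_selection (D \<inter> nbhd p n) (solutions P)"
    proof (rule has_selection_around_point[where S = "solutions P", OF q])
      fix k
      let ?\<rho> = "map q [0..<k]"
      obtain \<sigma> where \<sigma>: "\<sigma> \<sqsubseteq> p" and IH: "\<And>\<gamma> E. \<gamma> < \<alpha> \<Longrightarrow>
          E \<subseteq> dom (restrict_both P (cylinder \<sigma>) (cylinder ?\<rho>)) \<Longrightarrow>
          locally_max_rank r E \<Longrightarrow> (\<And>x. x \<in> E \<Longrightarrow> r x \<le> \<gamma>) \<Longrightarrow>
          has_selection E (solutions (restrict_both P (cylinder \<sigma>) (cylinder ?\<rho>)))"
        using answer[OF map_upt_initial_segment[of q k]] by blast
      have \<rho>: "cylinder ?\<rho> = nbhd q k"
        using cylinder_eq_nbhd[OF map_upt_initial_segment, of q k] by simp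
      \<comment> \<open>Within \<open>nbhd p s\<close> the ranks drop below \<open>r p\<close> and Player 2's answer \<open>\<sigma>\<close> is an initial segment.\<close>
      define s where "s = max n (length \<sigma>)"
      let ?E = "D \<inter> nbhd p s - {p}"
      have E: "?E \<subseteq> D \<inter> nbhd p n - {p}" "?E \<subseteq> cylinder \<sigma>"
        using nbhd_antimono[of n s p] nbhd_antimono[of "length \<sigma>" s p]
        by (auto simp: cylinder_eq_nbhd[OF \<sigma>] s_def)
      have "has_selection ?E (\<lambda>x. solutions P x \<inter> nbhd q k)"
      proof (rule has_selection_locally)
        fix x assume x: "x \<in> ?E"
        then obtain m where m: "\<And>y. y \<in> D \<inter> nbhd x m - {x} \<Longrightarrow> r y < r x"
          using two_winsI.prems(2) unfolding locally_max_rank_def by blast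
        let ?F = "?E \<inter> nbhd x m"
        have sub: "y \<in> dom P" "y \<in> cylinder \<sigma>" if "y \<in> ?F" for y
          using that E(2) two_winsI.prems(1) by auto
        have "r x < \<alpha>"
          using n[of x] x E(1) two_winsI.prems(3)[OF p] by (meson less_le_trans subsetD)
        then have "has_selection ?F (solutions (restrict_both P (cylinder \<sigma>) (cylinder ?\<rho>)))"
        proof (rule IH)
          show "?F \<subseteq> dom (restrict_both P (cylinder \<sigma>) (cylinder ?\<rho>))"
            using sub by (auto simp: dom_restrict_both)
          show "locally_max_rank r ?F"
            using two_winsI.prems(2) by (rule locally_max_rank_subset) blast
          show "r y \<le> r x" if "y \<in> ?F" for y
            using m[of y] that by (cases "y = x") auto
        qed
        then have "has_selection ?F (\<lambda>x. solutions P x \<inter> nbhd q k)"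
          by (rule has_selection_mono) (simp add: solutions_restrict_both sub \<rho>)
        then show "\<exists>m. has_selection (?E \<inter> nbhd x m) (\<lambda>x. solutions P x \<inter> nbhd q k)" ..
      qed
      then show "\<exists>s. has_selection (D \<inter> nbhd p s - {p}) (\<lambda>x. solutions P x \<inter> nbhd q k)" ..
    qed
  qed
qed

theorem corollary4p2p6:
  fixes P :: problem and \<alpha> :: omega1
  assumes "player2_has_winning_strategy \<alpha> P"
  shows "\<forall>A :: baire set. rankp A \<le> Fin \<alpha> \<longrightarrow> continuous_problem (P |` A)"
proof (intro allI impI)
  fix A :: "baire set" assume "rankp A \<le> Fin \<alpha>"
  then obtain r where r: "locally_max_rank r A" "\<And>p. p \<in> A \<Longrightarrow> r p \<le> \<alpha>"
    by (rule rankp_le_imp_rank_function) blast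
  have "has_selection (dom P \<inter> A) (solutions P)"
    using player2_has_winning_strategy_imp_two_wins[OF assms]
    by (rule two_wins_imp_has_selection[OF _ _ locally_max_rank_subset[OF r(1)]]) (auto simp: r(2))
  then have "has_selection (dom (P |` A)) (solutions (P |` A))"
    unfolding dom_restrict
    by (rule has_selection_mono) (auto simp: solutions_def)
  then show "continuous_problem (P |` A)"
    unfolding has_selection_def continuous_problem_def by blast
qed

end
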